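(* Let $n\ge 2$, let $\Omega\subset\mathbb{R}^2$ be open and simply connected, and let $A\in\mathcal{C}^1(\Omega,\mathbb{C}^{n\times n})$ have distinct singular values everywhere on $\Omega$. Let $\Gamma$ be a circle entirely contained in $\Omega$, and let $\beta_1,\dots,\beta_n$ be the phases accrued by the singular vectors of the joint-MVD of $A$ along $\Gamma$. Suppose $$\sum_{j=1}^n\beta_j=\pi \mod 2\pi .$$ Then there exists a point of loss of rank for $A$ (a point $\xi$ with $\operatorname{rank}A(\xi)<n$) inside the region enclosed by $\Gamma$.
   Context: Smooth SVD and joint-MVD: for $B\in\mathcal{C}^k([0,1],\mathbb{C}^{n\times n})$, $k\ge1$, with distinct singular values $\sigma_1(t)>\dots>\sigma_n(t)$ for all $t\in[0,1]$, a smooth SVD is a factorization $B(t)=U(t)\Sigma(t)V^*(t)$ with $U,V$ unitary, $\Sigma=\operatorname{diag}(\sigma_1,\dots,\sigma_n)$ and all factors of class $\mathcal{C}^k$ on $[0,1]$. A joint-MVD (joint minimum variation decomposition) of $B$ is a smooth SVD whose pair $(U,V)$ minimizes $$\int_0^1\sqrt{\|\dot U(t)\|_{\mathrm F}^2+\|\dot V(t)\|_{\mathrm F}^2}\,dt$$ among all smooth SVDs of $B$ over $[0,1]$, where $\|\cdot\|_{\mathrm F}$ is the Frobenius norm. Phases along $\Gamma$: if $\Gamma$ has center $\xi_c$ and radius $r>0$, parametrize it by $\gamma(t)=\xi_c+(r\cos(2\pi t),\,r\sin(2\pi t))$, $t\in[0,1]$, and let $A(\gamma(t))=U(t)\Sigma(t)V^*(t)$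 be the joint-MVD of $A(\gamma(\cdot))$ over $[0,1]$. The phases $\beta_j\in(-\pi,\pi]$ accrued by the singular vectors are defined by $U^*(0)U(1)=V^*(0)V(1)=\operatorname{diag}(e^{i\beta_1},\dots,e^{i\beta_n})$.
   Formalization: The point of loss of rank is asserted in the closed disk bounded by Γ, boundary included: if A loses rank on Γ itself, the open-disk claim can fail, e.g. A = diag(2, (z−1)²/100) on the unit circle. If A has full rank on Γ, the point lies strictly inside. *)

theory Defs
  imports "HOL-Analysis.Analysis" "HOL-Library.Real_Mod"
begin

type_synonym 'n cmat = "((complex, 'n) vec, 'n) vec"

definition ctranspose :: "complex^'n^'m \<Rightarrow> complex^'m^'n" where
  "ctranspose A = (\<chi> i j. cnj (A $ j $ i))"

definition unitary_matrix :: "complex^'n^'n \<Rightarrow> bool" where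
  "unitary_matrix U \<longleftrightarrow> ctranspose U ** U = mat 1 \<and> U ** ctranspose U = mat 1"

definition diag_matrix :: "('n \<Rightarrow> complex) \<Rightarrow> complex^'n^'n" where
  "diag_matrix d = (\<chi> i j. if i = j then d i else 0)"

text \<open>The library norm on matrices (as vectors of vectors) is the Frobenius norm.\<close>

lemma norm_matrix_eq_frobenius:
  fixes A :: "complex^'n^'m"
  shows "norm A = sqrt (\<Sum>i\<in>UNIV. \<Sum>j\<in>UNIV. (cmod (A $ i $ j))\<^sup>2)"
  by (simp add: norm_vec_def L2_set_def real_sqrt_pow2 sum_nonneg)

text \<open>Square roots of the eigenvalues of \<open>A\<^sup>* A\<close>. As \<open>A\<^sup>* A\<close> is Hermitian, the \<open>n\<close> singular values
  counted with multiplicity are pairwise distinct iff this set has \<open>n\<close> elements. Zero is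
  allowed as a singular value.\<close>

definition singular_values :: "complex^'n^'n \<Rightarrow> real set" where
  "singular_values A =
     {\<sigma>. 0 \<le> \<sigma> \<and> (\<exists>v. v \<noteq> 0 \<and> (ctranspose A ** A) *v v = complex_of_real (\<sigma>\<^sup>2) *s v)}"

definition distinct_singular_values :: "complex^'n^'n \<Rightarrow> bool" where
  "distinct_singular_values A \<longleftrightarrow> card (singular_values A) = CARD('n)"

text \<open>Class \<open>C\<^sup>1\<close> on an open subset of the plane, in the real sense.\<close>

definition C1_on_plane :: "(real \<times> real) set \<Rightarrow> (real \<times> real \<Rightarrow> 'a::real_normed_vector) \<Rightarrow> bool" where
  "C1_on_plane S f \<longleftrightarrow>
     (\<exists>f' :: real \<times> real \<Rightarrow> (real \<times> real) \<Rightarrow>\<^sub>L 'a.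
        (\<forall>\<xi>\<in>S. (f has_derivative blinfun_apply (f' \<xi>)) (at \<xi>)) \<and> continuous_on S f')"

text \<open>Class \<open>C\<^sup>k\<close> on a real interval, with one-sided derivatives at the end points it contains.\<close>

primrec Ck_on :: "nat \<Rightarrow> real set \<Rightarrow> (real \<Rightarrow> 'a::real_normed_vector) \<Rightarrow> bool" where
  "Ck_on 0 S f \<longleftrightarrow> continuous_on S f"
| "Ck_on (Suc k) S f \<longleftrightarrow>
     (\<exists>f'. (\<forall>t\<in>S. (f has_vector_derivative f' t) (at t within S)) \<and> Ck_on k S f')"

text \<open>The index type is linearly ordered so that \<open>\<sigma>\<^sub>1 > \<dots> > \<sigma>\<^sub>n\<close> can be expressed; \<open>\<Sigma>\<close> is given by
  its diagonal \<open>s\<close>. No continuity is required of \<open>U, s, V\<close> outside \<open>[0,1]\<close>.\<close>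

definition smooth_svd ::
  "nat \<Rightarrow> (real \<Rightarrow> ('n::{finite,linorder}) cmat) \<Rightarrow> (real \<Rightarrow> 'n cmat) \<Rightarrow> (real \<Rightarrow> (real, 'n) vec)
    \<Rightarrow> (real \<Rightarrow> 'n cmat) \<Rightarrow> bool" where
  "smooth_svd k B U s V \<longleftrightarrow>
     Ck_on k {0..1} U \<and> Ck_on k {0..1} s \<and> Ck_on k {0..1} V \<and>
     (\<forall>t\<in>{0..1}.
        unitary_matrix (U t) \<and> unitary_matrix (V t) \<and>
        (\<forall>i. 0 \<le> s t $ i) \<and> (\<forall>i j. i < j \<longrightarrow> s t $ j < s t $ i) \<and>
        B t = U t ** diag_matrix (\<lambda>i. complex_of_real (s t $ i)) ** ctranspose (V t))"

definition joint_variation ::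
  "(real \<Rightarrow> complex^'n^'n) \<Rightarrow> (real \<Rightarrow> complex^'n^'n) \<Rightarrow> real" where
  "joint_variation U V =
     integral {0..1} (\<lambda>t. sqrt ((norm (vector_derivative U (at t within {0..1})))\<^sup>2
                              + (norm (vector_derivative V (at t within {0..1})))\<^sup>2))"

definition joint_mvd ::
  "nat \<Rightarrow> (real \<Rightarrow> ('n::{finite,linorder}) cmat) \<Rightarrow> (real \<Rightarrow> 'n cmat) \<Rightarrow> (real \<Rightarrow> (real, 'n) vec)
    \<Rightarrow> (real \<Rightarrow> 'n cmat) \<Rightarrow> bool" where
  "joint_mvd k B U s V \<longleftrightarrow>
     smooth_svd k B U s V \<and>
     (\<forall>U' s' V'. smooth_svd k B U' s' V' \<longrightarrow> joint_variation U V \<le> joint_variation U' V')"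

definition accrued_phases ::
  "(real \<Rightarrow> complex^'n^'n) \<Rightarrow> (real \<Rightarrow> complex^'n^'n) \<Rightarrow> ('n \<Rightarrow> real) \<Rightarrow> bool" where
  "accrued_phases U V \<beta> \<longleftrightarrow>
     (\<forall>j. - pi < \<beta> j \<and> \<beta> j \<le> pi) \<and>
     ctranspose (U 0) ** U 1 = diag_matrix (\<lambda>j. cis (\<beta> j)) \<and>
     ctranspose (V 0) ** V 1 = diag_matrix (\<lambda>j. cis (\<beta> j))"

definition circle_param :: "real \<times> real \<Rightarrow> real \<Rightarrow> real \<Rightarrow> real \<times> real" where
  "circle_param c r t = c + (r * cos (2 * pi * t), r * sin (2 * pi * t))"

end

theory Submission
  imports Defs "HOL-Complex_Analysis.Cauchy_Integral_Formula"
begin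

text \<open>Write $\gamma$ for the circle and $\det A(\gamma) = \det U \cdot \rho \cdot \overline{\det V}$ with
  $\rho \ge 0$ the product of the singular values.

  The minimality of the joint-MVD enters through a gauge argument. Multiplying the $j$-th columns of
  $U$ and $V$ by a common phase $e^{i\varphi_j}$ gives another smooth SVD, and by completing the
  square the integrand of the variation is smallest, pointwise, when
  $2\dot\varphi_j = - \mathrm{Im}(u_j^* \dot u_j + v_j^* \dot v_j)$. A minimizer therefore satisfies
  $\mathrm{Im}(u_j^* \dot u_j + v_j^* \dot v_j) = 0$ for all $j$ and $t$
  (\<open>joint_mvd_column_phase_speeds_cancel\<close>). For unitary $U$ one has
  $(\det U)^\cdot = \det U \cdot i \sum_j \mathrm{Im}(u_j^* \dot u_j)$, and similarly for $V$, so
  $\det U \cdot \det V$ is a constant $c$ of modulus one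
  (\<open>joint_mvd_det_product_constant\<close>). Since $|\det U| = 1$, this turns the formula for
  $\det A(\gamma)$ into
  \[ \det A(\gamma(t)) = \overline c \, |\det A(\gamma(t))| \, (\det U(t))^2 . \]

  Suppose $A$ is invertible on the closed disc bounded by the circle, which lies in $\Omega$ because
  $\Omega$ is simply connected (\<open>cball_subset_simply_connected_plane\<close>). Then $\det A$ has a
  continuous logarithm on the disc, hence a continuous square root, and the continuous
  square root $|\det A(\gamma)|^{1/2} \det U$ of $c \det A(\gamma)$ along the loop must return to its
  initial value (\<open>square_factor_of_nonvanishing_returns\<close>). But
  $\det U(1) = e^{i \sum_j \beta_j} \det U(0) = - \det U(0)$, a contradiction.\<close>

section \<open>Derivatives of matrices and determinants\<close>

lemma has_vector_derivative_vec_lambda: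
  fixes f :: "real \<Rightarrow> 'i::finite \<Rightarrow> 'a::real_normed_vector"
  assumes "\<And>i. ((\<lambda>t. f t i) has_vector_derivative f' i) (at t within S)"
  shows "((\<lambda>t. \<chi> i. f t i) has_vector_derivative (\<chi> i. f' i)) (at t within S)"
  unfolding has_vector_derivative_def has_derivative_within
proof (intro conjI bounded_linear_scaleR_left)
  have "((\<lambda>y. (1 / norm (y - t)) *\<^sub>R (f y i - (f t i + (y - t) *\<^sub>R f' i))) \<longlongrightarrow> 0) (at t within S)" for i
    using assms[of i] unfolding has_vector_derivative_def has_derivative_within by blast
  then show "((\<lambda>y. (1 / norm (y - t)) *\<^sub>R ((\<chi> i. f y i) - ((\<chi> i. f t i) + (y - t) *\<^sub>R (\<chi> i. f' i))))
      \<longlongrightarrow> 0) (at t within S)"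
    by (intro vec_tendstoI) simp
qed

lemma has_vector_derivative_vec_nth:
  assumes "(f has_vector_derivative f') F"
  shows "((\<lambda>t. f t $ i) has_vector_derivative f' $ i) F"
  by (rule bounded_linear.has_vector_derivative[OF bounded_linear_vec_nth assms])

text \<open>Jacobi's formula at the identity: every permutation but the identity involves at least two
  off-diagonal entries, so its contribution vanishes to first order.\<close>

lemma det_has_vector_derivative_at_identity:
  fixes M :: "real \<Rightarrow> complex^'n^'n"
  assumes M: "(M has_vector_derivative M') (at t within S)" and id: "M t = mat 1"
  shows "((\<lambda>u. det (M u)) has_vector_derivative trace M') (at t within S)"
proof -
  let ?P = "{p. p permutes (UNIV :: 'n set)}"
  have entry: "((\<lambda>u. M u $ i $ j) has_derivative (\<lambda>h. h *\<^sub>R M' $ i $ j)) (at t within S)" for i j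
    using has_vector_derivative_vec_nth[OF has_vector_derivative_vec_nth[OF M]]
    by (simp add: has_vector_derivative_def)
  have "((\<lambda>u. det (M u)) has_derivative
      (\<lambda>h. \<Sum>p\<in>?P. of_int (sign p) *
        (\<Sum>i\<in>UNIV. h *\<^sub>R M' $ i $ p i * (\<Prod>j\<in>UNIV - {i}. M t $ j $ p j)))) (at t within S)"
    unfolding det_def by (intro derivative_intros entry)
  moreover have "(\<Sum>p\<in>?P. of_int (sign p) *
        (\<Sum>i\<in>UNIV. h *\<^sub>R M' $ i $ p i * (\<Prod>j\<in>UNIV - {i}. M t $ j $ p j))) = h *\<^sub>R trace M'" for h
  proof -
    \<comment> \<open>A permutation that moves some point moves at least two, so for \<open>p \<noteq> id\<close> deleting one factor
      still leaves an off-diagonal entry of the identity in the product.\<close>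
    have "(\<Prod>j\<in>UNIV - {i}. M t $ j $ p j) = 0" if p: "p permutes UNIV" "p \<noteq> id" for p i
    proof -
      have "\<exists>j. j \<noteq> i \<and> p j \<noteq> j"
      proof (rule ccontr)
        assume "\<not> ?thesis"
        then have others: "p j = j" if "j \<noteq> i" for j using that by blast
        moreover have "p i = i"
          using others[of "p i"] permutes_inj[OF p(1)] by (metis injD)
        ultimately have "p = id" by (auto simp: fun_eq_iff) (metis)
        with p(2) show False ..
      qed
      then obtain j where "j \<in> UNIV - {i}" "M t $ j $ p j = 0" by (auto simp: id mat_def)
      then show ?thesis by (intro prod_zero) auto
    qed
    then have "(\<Sum>p\<in>?P. of_int (sign p) *
        (\<Sum>i\<in>UNIV. h *\<^sub>R M' $ i $ p i * (\<Prod>j\<in>UNIV - {i}. M t $ j $ p j)))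
       = (\<Sum>p\<in>{id}. of_int (sign p) *
        (\<Sum>i\<in>UNIV. h *\<^sub>R M' $ i $ p i * (\<Prod>j\<in>UNIV - {i}. M t $ j $ p j)))"
      by (intro sum.mono_neutral_right ballI) (simp_all add: permutes_id finite_permutations del: prod_zero_iff)
    also have "\<dots> = h *\<^sub>R trace M'"
      by (simp add: id mat_def trace_def scaleR_sum_right)
    finally show ?thesis .
  qed
  ultimately show ?thesis by (simp add: has_vector_derivative_def)
qed

lemma trace_ctranspose_mult:
  "trace (ctranspose M ** N) = (\<Sum>j\<in>UNIV. \<Sum>i\<in>UNIV. cnj (M $ i $ j) * N $ i $ j)"
  by (simp add: trace_def matrix_matrix_mult_def ctranspose_def)

section \<open>Unitary matrices\<close>

lemma det_ctranspose: "det (ctranspose M) = cnj (det M)"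
proof -
  have "det (ctranspose M) = det (transpose (ctranspose M))" by simp
  also have "\<dots> = cnj (det M)"
    by (simp add: det_def ctranspose_def transpose_def)
  finally show ?thesis .
qed

lemma det_diag_matrix: "det (diag_matrix d) = prod d UNIV"
  by (subst det_diagonal) (auto simp: diag_matrix_def)

lemma cmod_det_unitary:
  assumes "unitary_matrix U"
  shows "cmod (det U) = 1"
proof -
  have "cnj (det U) * det U = 1"
    using assms by (metis det_I det_ctranspose det_mul unitary_matrix_def)
  then have "(cmod (det U))\<^sup>2 = 1"
    by (metis complex_norm_square mult.commute of_real_eq_1_iff)
  then show ?thesis using power2_eq_imp_eq[of "cmod (det U)" 1] by simp
qed

lemma unitary_column_norm:
  assumes "unitary_matrix U"
  shows "(\<Sum>i\<in>UNIV. (cmod (U $ i $ j))\<^sup>2) = 1"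
proof -
  have "(ctranspose U ** U) $ j $ j = 1"
    using assms by (simp add: unitary_matrix_def mat_def)
  then have "complex_of_real (\<Sum>i\<in>UNIV. (cmod (U $ i $ j))\<^sup>2) = 1"
    by (simp add: matrix_matrix_mult_def ctranspose_def complex_norm_square mult.commute
        del: of_real_power)
  then show ?thesis using of_real_eq_1_iff by blast
qed

lemma norm_matrix_squared:
  fixes A :: "complex^'n^'m"
  shows "(norm A)\<^sup>2 = (\<Sum>j\<in>UNIV. \<Sum>i\<in>UNIV. (cmod (A $ i $ j))\<^sup>2)"
  unfolding norm_matrix_eq_frobenius
  by (subst sum.swap) (simp add: sum_nonneg)

section \<open>Rotating the phases of the columns\<close>

text \<open>For a curve $M$ of matrices with orthonormal columns $m_j$ and velocity $M'$, this is
  $\mathrm{Im}(m_j^* m_j')$, the speed at which the $j$-th column turns in its own complex line.\<close>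

definition column_phase_speed :: "complex^'n^'m \<Rightarrow> complex^'n^'m \<Rightarrow> 'n \<Rightarrow> real" where
  "column_phase_speed M M' j = (\<Sum>i\<in>UNIV. Im (cnj (M $ i $ j) * M' $ i $ j))"

definition rotate_columns :: "('n \<Rightarrow> real) \<Rightarrow> complex^'n^'m \<Rightarrow> complex^'n^'m" where
  "rotate_columns \<phi> M = (\<chi> i j. M $ i $ j * cis (\<phi> j))"

text \<open>The real part vanishes because $U$ keeps the Frobenius norm $\sqrt n$; the imaginary part
  is the sum of those of the diagonal entries $u_j^* \dot u_j$.\<close>

lemma trace_unitary_derivative:
  fixes U :: "real \<Rightarrow> complex^'n^'n"
  assumes U: "(U has_vector_derivative U') (at t within {0..1})"
    and unitary: "\<And>t. t \<in> {0..1} \<Longrightarrow> unitary_matrix (U t)" and t: "t \<in> {0..1}"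
  shows "trace (ctranspose (U t) ** U') = \<i> * of_real (\<Sum>j\<in>UNIV. column_phase_speed (U t) U' j)"
proof (rule complex_eqI)
  have "((\<lambda>t. inner (U t) (U t)) has_vector_derivative inner (U t) U' + inner U' (U t))
      (at t within {0..1})"
    by (rule bounded_bilinear.has_vector_derivative[OF bounded_bilinear_inner U U])
  moreover have "((\<lambda>t. inner (U t) (U t)) has_vector_derivative 0) (at t within {0..1})"
  proof (rule has_vector_derivative_transform[OF t _ has_vector_derivative_const])
    show "inner (U x) (U x) = real CARD('n)" if "x \<in> {0..1}" for x
      using unitary_column_norm[OF unitary[OF that]]
      by (simp add: norm_matrix_squared flip: power2_norm_eq_inner)
  qed
  ultimately have "inner (U t) U' + inner U' (U t) = 0"
    using t by (intro vector_derivative_unique_within[of t "{0..1}"]) 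
      (auto simp: trivial_limit_within islimpt_Icc)
  then have "inner (U t) U' = 0" by (simp add: inner_commute)
  moreover have "Re (trace (ctranspose (U t) ** U')) = inner (U t) U'"
    unfolding trace_ctranspose_mult Re_sum inner_vec_def
    by (subst sum.swap) (simp add: inner_complex_def)
  ultimately show "Re (trace (ctranspose (U t) ** U')) =
      Re (\<i> * of_real (\<Sum>j\<in>UNIV. column_phase_speed (U t) U' j))"
    by simp
  show "Im (trace (ctranspose (U t) ** U')) =
      Im (\<i> * of_real (\<Sum>j\<in>UNIV. column_phase_speed (U t) U' j))"
    unfolding trace_ctranspose_mult Im_sum by (simp add: column_phase_speed_def)
qed

text \<open>Left translation by \<open>ctranspose (U t)\<close> moves the curve to the identity at time \<open>t\<close>, where the
  derivative of the determinant is the trace.\<close>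

lemma det_unitary_has_vector_derivative:
  fixes U :: "real \<Rightarrow> complex^'n^'n"
  assumes U: "(U has_vector_derivative U') (at t within {0..1})"
    and unitary: "\<And>t. t \<in> {0..1} \<Longrightarrow> unitary_matrix (U t)" and t: "t \<in> {0..1}"
  shows "((\<lambda>t. det (U t)) has_vector_derivative
      det (U t) * (\<i> * of_real (\<Sum>j\<in>UNIV. column_phase_speed (U t) U' j))) (at t within {0..1})"
proof -
  let ?L = "\<lambda>M. ctranspose (U t) ** M"
  have "((\<lambda>u. ?L (U u)) has_vector_derivative ?L U') (at t within {0..1})"
    using U unfolding matrix_matrix_mult_def
    by (intro has_vector_derivative_vec_lambda has_vector_derivative_sum
        has_vector_derivative_mult_right has_vector_derivative_vec_nth)
  moreover have "?L (U t) = mat 1" using unitary[OF t] by (simp add: unitary_matrix_def)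
  ultimately have "((\<lambda>u. det (?L (U u))) has_vector_derivative trace (?L U')) (at t within {0..1})"
    by (rule det_has_vector_derivative_at_identity)
  then have "((\<lambda>u. det (U t) * det (?L (U u))) has_vector_derivative det (U t) * trace (?L U'))
      (at t within {0..1})"
    by (rule has_vector_derivative_mult_right)
  moreover have "det (U t) * det (?L M) = det M" for M
    using unitary[OF t] unfolding unitary_matrix_def
    by (metis det_mul matrix_mul_assoc matrix_mul_lid)
  ultimately show ?thesis
    using trace_unitary_derivative[OF assms] by simp
qed

lemma unitary_rotate_columns:
  assumes "unitary_matrix U"
  shows "unitary_matrix (rotate_columns \<phi> U)"
proof -
  have "ctranspose (rotate_columns \<phi> U) ** rotate_columns \<phi> U = mat 1"
  proof -
    have "(\<Sum>k\<in>UNIV. cnj (U $ k $ i) * cnj (cis (\<phi> i)) * (U $ k $ j * cis (\<phi> j)))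
        = cnj (cis (\<phi> i)) * cis (\<phi> j) * (ctranspose U ** U) $ i $ j" for i j
      by (simp add: matrix_matrix_mult_def ctranspose_def sum_distrib_left ac_simps)
    moreover have "cnj (cis x) * cis x = 1" for x
      by (simp add: cis_cnj cis_mult)
    ultimately show ?thesis
      using assms by (simp add: unitary_matrix_def vec_eq_iff mat_def matrix_matrix_mult_def
          ctranspose_def rotate_columns_def)
  qed
  then show ?thesis
    by (simp add: unitary_matrix_def matrix_left_right_inverse)
qed

lemma diagonal_product_entry:
  fixes U V :: "complex^'n^'n"
  shows "(U ** diag_matrix d ** ctranspose V) $ i $ j = (\<Sum>k\<in>UNIV. U $ i $ k * d k * cnj (V $ j $ k))"
  by (simp add: matrix_matrix_mult_def diag_matrix_def ctranspose_def if_distrib[where f = "(*) _"]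
      cong: if_cong)

text \<open>The phases of matching singular vectors cancel, so every SVD leaves the freedom of a common rotation
  of the columns. The minimality of a joint-MVD is tested against this freedom.\<close>

lemma rotate_columns_svd_product:
  fixes U V :: "complex^'n^'n"
  shows "rotate_columns \<phi> U ** diag_matrix d ** ctranspose (rotate_columns \<phi> V)
    = U ** diag_matrix d ** ctranspose V"
proof -
  have "a * cis x * d * (cnj (b * cis x)) = a * d * cnj b * (cis x * cis (- x))" for a b d x
    by (simp add: cis_cnj ac_simps)
  then have cancel: "a * cis x * d * (cnj (b * cis x)) = a * d * cnj b" for a b d x
    by (simp add: cis_mult)
  show ?thesis
    by (simp only: vec_eq_iff diagonal_product_entry rotate_columns_def vec_lambda_beta cancel) simp
qed

text \<open>The velocity of \<open>rotate_columns \<phi> M\<close> when \<open>M\<close> moves with velocity \<open>M'\<close> and the angles \<open>\<phi>\<close>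
  with velocity \<open>\<omega>\<close>. The phases stand outside as factors of modulus one and so do not affect
  the norm.\<close>

definition rotated_velocity ::
  "('n \<Rightarrow> real) \<Rightarrow> ('n \<Rightarrow> real) \<Rightarrow> complex^'n^'m \<Rightarrow> complex^'n^'m \<Rightarrow> complex^'n^'m" where
  "rotated_velocity \<phi> \<omega> M M' =
     rotate_columns \<phi> (\<chi> i j. M' $ i $ j + \<i> * of_real (\<omega> j) * M $ i $ j)"

lemma rotate_columns_has_vector_derivative:
  fixes M :: "real \<Rightarrow> complex^'n^'m"
  assumes M: "(M has_vector_derivative M') (at t within S)"
    and \<phi>: "\<And>j. ((\<lambda>t. \<phi> t j) has_vector_derivative \<omega> j) (at t within S)"
  shows "((\<lambda>t. rotate_columns (\<phi> t) (M t)) has_vector_derivative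
    rotated_velocity (\<phi> t) \<omega> (M t) M') (at t within S)"
  unfolding rotate_columns_def rotated_velocity_def
proof (intro has_vector_derivative_vec_lambda, simp)
  fix i j
  have "((\<lambda>t. cis (\<phi> t j)) has_vector_derivative \<omega> j *\<^sub>R (\<i> * cis (\<phi> t j))) (at t within S)"
    using has_derivative_cis[OF \<phi>[of j, unfolded has_vector_derivative_def]]
    by (simp add: has_vector_derivative_def)
  from has_vector_derivative_mult[OF has_vector_derivative_vec_nth[OF has_vector_derivative_vec_nth[OF M]] this]
  show "((\<lambda>t. M t $ i $ j * cis (\<phi> t j)) has_vector_derivative
      (M' $ i $ j + \<i> * of_real (\<omega> j) * M t $ i $ j) * cis (\<phi> t j)) (at t within S)"
    by (simp add: algebra_simps scaleR_conv_of_real)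
qed

text \<open>The unit columns make this a quadratic polynomial in the angular velocities with leading
  coefficient one, whose linear coefficients are twice the phase speeds; its minimum can be read off.\<close>

lemma norm_rotated_velocity:
  assumes "unitary_matrix M"
  shows "(norm (rotated_velocity \<phi> \<omega> M M'))\<^sup>2 =
    (norm M')\<^sup>2 + (\<Sum>j\<in>UNIV. 2 * \<omega> j * column_phase_speed M M' j + (\<omega> j)\<^sup>2)"
proof -
  have entry: "(cmod ((x + \<i> * of_real w * u) * cis p))\<^sup>2
      = (cmod x)\<^sup>2 + 2 * w * Im (cnj u * x) + w\<^sup>2 * (cmod u)\<^sup>2" for x u w p
    unfolding norm_mult norm_cis cmod_power2 mult_1_right by (simp add: power2_eq_square algebra_simps)
  have "(\<Sum>i\<in>UNIV. (cmod (rotated_velocity \<phi> \<omega> M M' $ i $ j))\<^sup>2)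
      = (\<Sum>i\<in>UNIV. (cmod (M' $ i $ j))\<^sup>2) + (2 * \<omega> j * column_phase_speed M M' j + (\<omega> j)\<^sup>2)" for j
    using unitary_column_norm[OF assms, of j]
    by (simp add: rotated_velocity_def rotate_columns_def entry sum.distrib column_phase_speed_def
        flip: sum_distrib_left)
  then show ?thesis by (simp add: norm_matrix_squared sum.distrib)
qed

section \<open>The first-order condition for a joint-MVD\<close>

lemma Ck_on_1:
  "Ck_on 1 S f \<longleftrightarrow>
    (\<exists>f'. (\<forall>t\<in>S. (f has_vector_derivative f' t) (at t within S)) \<and> continuous_on S f')"
  by (simp add: One_nat_def)

lemma joint_variation_eq_integral:
  assumes "\<And>t. t \<in> {0..1} \<Longrightarrow> (U has_vector_derivative U' t) (at t within {0..1})"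
    and "\<And>t. t \<in> {0..1} \<Longrightarrow> (V has_vector_derivative V' t) (at t within {0..1})"
  shows "joint_variation U V = integral {0..1} (\<lambda>t. sqrt ((norm (U' t))\<^sup>2 + (norm (V' t))\<^sup>2))"
  unfolding joint_variation_def
proof (rule integral_cong)
  fix t :: real assume t: "t \<in> {0..1}"
  then show "sqrt ((norm (vector_derivative U (at t within {0..1})))\<^sup>2
      + (norm (vector_derivative V (at t within {0..1})))\<^sup>2) = sqrt ((norm (U' t))\<^sup>2 + (norm (V' t))\<^sup>2)"
    using vector_derivative_within_closed_interval[OF _ t assms(1)[OF t]]
      vector_derivative_within_closed_interval[OF _ t assms(2)[OF t]] by simp
qed

lemma smooth_svd_rotate_columns:
  fixes U V :: "real \<Rightarrow> ('n::{finite,linorder}) cmat"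
  assumes svd: "smooth_svd 1 B U s V"
    and \<phi>: "\<And>j t. t \<in> {0..1} \<Longrightarrow> ((\<lambda>t. \<phi> t j) has_vector_derivative \<omega> t j) (at t within {0..1})"
    and \<omega>: "\<And>j. continuous_on {0..1} (\<lambda>t. \<omega> t j)"
  shows "smooth_svd 1 B (\<lambda>t. rotate_columns (\<phi> t) (U t)) s (\<lambda>t. rotate_columns (\<phi> t) (V t))"
proof -
  have C1: "Ck_on 1 {0..1} (\<lambda>t. rotate_columns (\<phi> t) (M t))"
    if M: "Ck_on 1 {0..1} M" for M :: "real \<Rightarrow> 'n cmat"
  proof -
    from M obtain M' where M': "\<And>t. t \<in> {0..1} \<Longrightarrow> (M has_vector_derivative M' t) (at t within {0..1})"
      and contM': "continuous_on {0..1} M'"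
      unfolding Ck_on_1 by blast
    have contM: "continuous_on {0..1} M"
      using M' by (intro continuous_on_vector_derivative)
    have cont\<phi>: "continuous_on {0..1} (\<lambda>t. \<phi> t j)" for j
      using \<phi> by (intro continuous_on_vector_derivative)
    have "continuous_on {0..1} (\<lambda>t. rotated_velocity (\<phi> t) (\<omega> t) (M t) (M' t))"
      unfolding rotated_velocity_def rotate_columns_def
      by (simp, intro continuous_intros contM contM' cont\<phi> \<omega>)
    then show ?thesis
      unfolding Ck_on_1
      by (intro exI[of _ "\<lambda>t. rotated_velocity (\<phi> t) (\<omega> t) (M t) (M' t)"] conjI ballI
          rotate_columns_has_vector_derivative M' \<phi>)
  qed
  from svd show ?thesis
    unfolding smooth_svd_def
    by (simp add: C1 unitary_rotate_columns rotate_columns_svd_product del: Ck_on.simps One_nat_def)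
qed

text \<open>Otherwise a common rotation of the columns of \<open>U\<close> and \<open>V\<close> would lower the variation: turning the
  \<open>j\<close>-th columns at the rate of minus one half of the total speed on the left-hand side lowers the
  squared integrand by one half of the sum of the squares of these speeds. Since everything is
  continuous up to the end points, the conclusion holds at each \<open>t\<close>, not just almost everywhere.\<close>

lemma joint_mvd_column_phase_speeds_cancel:
  fixes U V :: "real \<Rightarrow> ('n::{finite,linorder}) cmat"
  assumes mvd: "joint_mvd 1 B U s V"
    and U: "\<And>t. t \<in> {0..1} \<Longrightarrow> (U has_vector_derivative U' t) (at t within {0..1})"
    and V: "\<And>t. t \<in> {0..1} \<Longrightarrow> (V has_vector_derivative V' t) (at t within {0..1})"
    and contU': "continuous_on {0..1} U'" and contV': "continuous_on {0..1} V'"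
    and t: "t \<in> {0..1}"
  shows "column_phase_speed (U t) (U' t) j + column_phase_speed (V t) (V' t) j = 0"
proof -
  from mvd have svd: "smooth_svd 1 B U s V"
    and minimal: "\<And>U1 s1 V1. smooth_svd 1 B U1 s1 V1 \<Longrightarrow> joint_variation U V \<le> joint_variation U1 V1"
    by (auto simp: joint_mvd_def)
  have unitary: "unitary_matrix (U t)" "unitary_matrix (V t)" if "t \<in> {0..1}" for t
    using svd that by (auto simp: smooth_svd_def)
  define w where "w t j = column_phase_speed (U t) (U' t) j + column_phase_speed (V t) (V' t) j" for t j
  \<comment> \<open>The minimizer of \<open>2 * x * w t j + 2 * x\<^sup>2\<close>; the rotation acts on \<open>U\<close> and on \<open>V\<close>, whence
    the factor two in front of the square.\<close>
  define \<omega> where "\<omega> t j = - (1/2) * w t j" for t j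
  define \<phi> where "\<phi> t j = integral {0..t} (\<lambda>t. \<omega> t j)" for t j
  have contU: "continuous_on {0..1} U" and contV: "continuous_on {0..1} V"
    using continuous_on_vector_derivative[OF U] continuous_on_vector_derivative[OF V] by auto
  have cont_w: "continuous_on {0..1} (\<lambda>t. w t j)" for j
    unfolding w_def column_phase_speed_def
    by (intro continuous_intros contU contV contU' contV')
  then have cont_\<omega>: "continuous_on {0..1} (\<lambda>t. \<omega> t j)" for j
    unfolding \<omega>_def by (intro continuous_intros)
  have \<phi>: "((\<lambda>t. \<phi> t j) has_vector_derivative \<omega> t j) (at t within {0..1})" if "t \<in> {0..1}" for t j
    unfolding \<phi>_def using integral_has_vector_derivative[OF cont_\<omega> that] .
  define speed where "speed t = sqrt ((norm (U' t))\<^sup>2 + (norm (V' t))\<^sup>2)" for t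
  define slower where "slower t = sqrt ((norm (U' t))\<^sup>2 + (norm (V' t))\<^sup>2 - (\<Sum>j\<in>UNIV. (w t j)\<^sup>2) / 2)" for t
  have rotated_speed: "(norm (rotated_velocity (\<phi> t) (\<omega> t) (U t) (U' t)))\<^sup>2
      + (norm (rotated_velocity (\<phi> t) (\<omega> t) (V t) (V' t)))\<^sup>2
      = (norm (U' t))\<^sup>2 + (norm (V' t))\<^sup>2 - (\<Sum>j\<in>UNIV. (w t j)\<^sup>2) / 2"
    if "t \<in> {0..1}" for t
  proof -
    have "(2 * \<omega> t j * column_phase_speed (U t) (U' t) j + (\<omega> t j)\<^sup>2)
        + (2 * \<omega> t j * column_phase_speed (V t) (V' t) j + (\<omega> t j)\<^sup>2) = - ((w t j)\<^sup>2 / 2)" for j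
      unfolding \<omega>_def w_def by (simp add: power2_eq_square field_simps)
    then have "(\<Sum>j\<in>UNIV. 2 * \<omega> t j * column_phase_speed (U t) (U' t) j + (\<omega> t j)\<^sup>2)
        + (\<Sum>j\<in>UNIV. 2 * \<omega> t j * column_phase_speed (V t) (V' t) j + (\<omega> t j)\<^sup>2)
        = - (\<Sum>j\<in>UNIV. (w t j)\<^sup>2) / 2"
      by (simp add: sum_negf sum_divide_distrib flip: sum.distrib)
    then show ?thesis
      by (simp only: norm_rotated_velocity[OF unitary(1)[OF that]] norm_rotated_velocity[OF unitary(2)[OF that]])
  qed
  have "joint_variation U V \<le>
      joint_variation (\<lambda>t. rotate_columns (\<phi> t) (U t)) (\<lambda>t. rotate_columns (\<phi> t) (V t))"
    by (rule minimal[OF smooth_svd_rotate_columns[OF svd \<phi> cont_\<omega>]])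
  also have "\<dots> = integral {0..1} slower"
    using joint_variation_eq_integral[OF rotate_columns_has_vector_derivative[OF U \<phi>]
        rotate_columns_has_vector_derivative[OF V \<phi>]]
    by (simp only: rotated_speed slower_def cong: integral_cong)
  finally have le: "integral {0..1} speed \<le> integral {0..1} slower"
    unfolding speed_def by (simp only: joint_variation_eq_integral[OF U V])
  have cont_speed: "continuous_on {0..1} speed" and cont_slower: "continuous_on {0..1} slower"
    unfolding speed_def slower_def by (intro continuous_intros contU' contV' cont_w; simp)+
  have slower_le: "slower t \<le> speed t" for t
    unfolding speed_def slower_def by (simp add: sum_nonneg)
  have diff: "integral {0..1} (\<lambda>t. speed t - slower t) = integral {0..1} speed - integral {0..1} slower"
    by (intro integral_diff integrable_continuous_real cont_speed cont_slower)
  have "integral {0..1} (\<lambda>t. speed t - slower t) = 0"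
  proof (rule antisym)
    show "0 \<le> integral {0..1} (\<lambda>t. speed t - slower t)"
      using slower_le by (intro integral_nonneg integrable_continuous_real continuous_intros cont_speed cont_slower) simp
  qed (use diff le in simp)
  then have "speed t - slower t = 0"
    using integral_eq_0_iff[OF continuous_on_diff[OF cont_speed cont_slower]] slower_le t by simp
  then have "(\<Sum>j\<in>UNIV. (w t j)\<^sup>2) = 0"
    by (simp add: speed_def slower_def)
  then show ?thesis
    by (simp add: sum_nonneg_eq_0_iff w_def)
qed

text \<open>The logarithmic derivatives of the two determinants are \<open>\<i>\<close> times the sums of the phase speeds
  of the columns, and these sums cancel.\<close>

lemma joint_mvd_det_product_constant:
  fixes U V :: "real \<Rightarrow> ('n::{finite,linorder}) cmat"
  assumes mvd: "joint_mvd 1 B U s V"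
  obtains c where "\<And>t. t \<in> {0..1} \<Longrightarrow> det (U t) * det (V t) = c"
proof -
  from mvd have svd: "smooth_svd 1 B U s V" by (simp add: joint_mvd_def)
  then obtain U' V' where
      U: "\<And>t. t \<in> {0..1} \<Longrightarrow> (U has_vector_derivative U' t) (at t within {0..1})" "continuous_on {0..1} U'"
    and V: "\<And>t. t \<in> {0..1} \<Longrightarrow> (V has_vector_derivative V' t) (at t within {0..1})" "continuous_on {0..1} V'"
    unfolding smooth_svd_def Ck_on_1 by blast
  have unitary: "unitary_matrix (U t)" "unitary_matrix (V t)" if "t \<in> {0..1}" for t
    using svd that by (auto simp: smooth_svd_def)
  have "((\<lambda>t. det (U t) * det (V t)) has_derivative (\<lambda>h. 0)) (at t within {0..1})"
    if t: "t \<in> {0..1}" for t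
  proof -
    let ?a = "\<Sum>j\<in>UNIV. column_phase_speed (U t) (U' t) j"
    let ?b = "\<Sum>j\<in>UNIV. column_phase_speed (V t) (V' t) j"
    have "?a + ?b = 0"
      unfolding sum.distrib[symmetric]
      by (intro sum.neutral ballI joint_mvd_column_phase_speeds_cancel[OF mvd U(1) V(1) U(2) V(2) t])
    then have b: "?b = - ?a" by simp
    have "((\<lambda>t. det (U t) * det (V t)) has_vector_derivative
        det (U t) * (det (V t) * (\<i> * of_real ?b)) + det (U t) * (\<i> * of_real ?a) * det (V t))
        (at t within {0..1})"
      by (intro has_vector_derivative_mult det_unitary_has_vector_derivative U V unitary t)
    then show ?thesis
      unfolding b by (simp add: has_vector_derivative_def)
  qed
  then have "\<exists>c. \<forall>t\<in>{0..1}. det (U t) * det (V t) = c"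
    by (intro has_derivative_zero_constant) simp_all
  with that show thesis by blast
qed

section \<open>Continuous square roots on a disc\<close>

text \<open>A circle winds once around each point that it encloses, so it would not be contractible in
  a set that misses one of these points. Identifying the plane with the complex numbers makes
  winding numbers available.\<close>

lemma cball_subset_simply_connected_plane:
  fixes \<Omega> :: "(real \<times> real) set"
  assumes \<Omega>: "simply_connected \<Omega>" and r: "r > 0" and sphere: "sphere c r \<subseteq> \<Omega>"
  shows "cball c r \<subseteq> \<Omega>"
proof
  fix p assume p: "p \<in> cball c r"
  define f where "f = (\<lambda>p :: real \<times> real. Complex (fst p) (snd p))"
  define g where "g z = (Re z, Im z)" for z
  have fg [simp]: "f (g z) = z" "g (f q) = q" for z q by (auto simp: f_def g_def)
  have dist_f: "dist (f a) (f b) = dist a b" for a b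
    by (simp add: f_def dist_prod_def dist_real_def dist_norm cmod_def)
  have "\<Omega> homeomorphic f ` \<Omega>"
    unfolding homeomorphic_def homeomorphism_def
    by (intro exI[of _ f] exI[of _ g]) 
      (auto simp: image_image f_def[unfolded Complex_eq] g_def intro!: continuous_intros)
  then have sc: "simply_connected (f ` \<Omega>)" using \<Omega> homeomorphic_simply_connected by blast
  have "sphere (f c) r \<subseteq> f ` \<Omega>"
  proof
    fix z assume "z \<in> sphere (f c) r"
    then have "g z \<in> sphere c r" using dist_f[of c "g z"] by simp
    then show "z \<in> f ` \<Omega>" using sphere by (metis fg(1) imageI subsetD)
  qed
  then have circle: "path_image (circlepath (f c) r) \<subseteq> f ` \<Omega>" using r by simp
  show "p \<in> \<Omega>"
  proof (cases "dist c p = r")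
    case False
    with p have "norm (f p - f c) < r" using dist_f[of p c] by (simp add: dist_norm norm_minus_commute)
    then have "winding_number (circlepath (f c) r) (f p) = 1"
      by (rule winding_number_circlepath)
    then have "f p \<in> f ` \<Omega>"
      using simply_connected_imp_winding_number_zero[OF sc _ circle, of "f p"] by force
    then show ?thesis by (metis fg(2) imageE)
  qed (use sphere in auto)
qed

text \<open>Dividing \<open>g\<close> by the restriction to the loop of a continuous square root of \<open>F\<close> leaves a function
  whose square is constant. It is continuous with at most two values, hence constant, and the
  square root of \<open>F\<close> has the same value at both ends of the loop.\<close>

lemma square_factor_of_nonvanishing_returns:
  fixes F :: "'a::real_normed_vector \<Rightarrow> complex"
  assumes F: "continuous_on (cball a r) F" "\<And>z. z \<in> cball a r \<Longrightarrow> F z \<noteq> 0"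
    and \<gamma>: "continuous_on {0..1} \<gamma>" "\<gamma> \<in> {0..1} \<rightarrow> cball a r" "\<gamma> 1 = \<gamma> 0"
    and g: "continuous_on {0..1::real} g" "\<And>t. t \<in> {0..1} \<Longrightarrow> F (\<gamma> t) = c * (g t)\<^sup>2"
  shows "g 1 = g 0"
proof -
  obtain h where h: "continuous_on (cball a r) h" "\<And>z. z \<in> cball a r \<Longrightarrow> F z = exp (h z)"
    using continuous_logarithm_on_cball[OF F] by blast
  define k where "k t = g t / exp (h (\<gamma> t) / 2)" for t
  have "continuous_on {0..1} (\<lambda>t. h (\<gamma> t))"
    using continuous_on_compose2[OF h(1) \<gamma>(1)] \<gamma>(2) by auto
  then have "continuous_on {0..1} k"
    unfolding k_def by (intro continuous_intros g(1)) auto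
  moreover have "c * (k t)\<^sup>2 = 1" if "t \<in> {0..1}" for t
  proof -
    have "\<gamma> t \<in> cball a r" using \<gamma>(2) that by auto
    then have "c * (g t)\<^sup>2 = exp (h (\<gamma> t))" using g(2)[OF that] h(2) by simp
    also have "\<dots> = (exp (h (\<gamma> t) / 2))\<^sup>2" by (simp flip: exp_double)
    finally show ?thesis by (simp add: k_def power_divide)
  qed
  then have "(k t)\<^sup>2 = (csqrt (1 / c))\<^sup>2" if "t \<in> {0..1}" for t
    using that by (metis nonzero_eq_divide_eq mult.commute mult_zero_left power2_csqrt zero_neq_one)
  then have "k ` {0..1} \<subseteq> {csqrt (1 / c), - csqrt (1 / c)}"
    unfolding power2_eq_iff by blast
  then have "finite (k ` {0..1})" by (rule finite_subset) simp
  ultimately have "k constant_on {0..1}"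
    by (intro continuous_finite_range_constant) auto
  then have "k 1 = k 0" by (auto simp: constant_on_def)
  then show ?thesis using \<gamma>(3) by (simp add: k_def)
qed

section \<open>Loss of rank inside the circle\<close>

lemma rank_less_if_det_eq_0:
  fixes A :: "'a::field^'n^'n"
  assumes "det A = 0"
  shows "rank A < CARD('n)"
proof (rule ccontr)
  assume "\<not> ?thesis"
  moreover have "rank A \<le> CARD('n)"
    using vec.dim_subset_UNIV[of "rows A"] by (simp add: row_rank_def_gen vec.dimension_def card_cart_basis)
  ultimately have "vec.dim (rows A) = vec.dimension TYPE('a) TYPE('n)"
    by (simp add: row_rank_def_gen vec.dimension_def card_cart_basis)
  then obtain B where "B ** A = mat 1"
    using vec.dim_eq_full matrix_left_invertible_span_rows_gen by blast
  then have "det B * det A = 1" by (metis det_I det_mul)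
  with assms show False by simp
qed

lemma prod_cis: "(\<Prod>j\<in>S. cis (f j)) = cis (\<Sum>j\<in>S. f j)"
  by (induction S rule: infinite_finite_induct) (auto simp: cis_mult)

theorem corollary3p13:
  fixes \<Omega> :: "(real \<times> real) set"
    and A :: "real \<times> real \<Rightarrow> ('n::{finite,linorder}) cmat"
    and \<xi>c :: "real \<times> real" and r :: real
    and U V :: "real \<Rightarrow> 'n cmat" and s :: "real \<Rightarrow> (real, 'n) vec"
    and \<beta> :: "'n \<Rightarrow> real"
  assumes "CARD('n) \<ge> 2"
    and "open \<Omega>" and "simply_connected \<Omega>"
    and "C1_on_plane \<Omega> A"
    and "\<And>\<xi>. \<xi> \<in> \<Omega> \<Longrightarrow> distinct_singular_values (A \<xi>)"
    and "r > 0" and "sphere \<xi>c r \<subseteq> \<Omega>"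
    and "joint_mvd 1 (\<lambda>t. A (circle_param \<xi>c r t)) U s V"
    and "accrued_phases U V \<beta>"
    and "[(\<Sum>j\<in>UNIV. \<beta> j) = pi] (rmod (2 * pi))"
  shows "\<exists>\<xi>\<in>cball \<xi>c r. rank (A \<xi>) < CARD('n)"
proof (rule ccontr)
  assume no_loss: "\<not> ?thesis"
  let ?\<gamma> = "circle_param \<xi>c r"
  have nz: "det (A \<xi>) \<noteq> 0" if "\<xi> \<in> cball \<xi>c r" for \<xi>
    using no_loss rank_less_if_det_eq_0 that by blast
  obtain A' where "\<And>\<xi>. \<xi> \<in> \<Omega> \<Longrightarrow> (A has_derivative blinfun_apply (A' \<xi>)) (at \<xi>)"
    using assms(4) unfolding C1_on_plane_def by blast
  then have "continuous_on \<Omega> A"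
    by (rule has_derivative_continuous_on[OF has_derivative_at_withinI])
  then have contA: "continuous_on (cball \<xi>c r) A"
    using cball_subset_simply_connected_plane[OF assms(3,6,7)] by (rule continuous_on_subset)
  have cont_det: "continuous_on S (\<lambda>x. det (M x))" if "continuous_on S M"
    for S and M :: "'b::topological_space \<Rightarrow> 'n cmat"
    unfolding det_def by (intro continuous_intros that)
  have \<gamma>: "continuous_on {0..1} ?\<gamma>" "?\<gamma> \<in> {0..1} \<rightarrow> cball \<xi>c r" "?\<gamma> 1 = ?\<gamma> 0"
  proof -
    show "continuous_on {0..1} ?\<gamma>" unfolding circle_param_def by (intro continuous_intros)
    have "dist \<xi>c (?\<gamma> t) = r" for t
      using \<open>r > 0\<close> by (simp add: circle_param_def dist_norm norm_Pair power_mult_distrib flip: distrib_left)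
    then show "?\<gamma> \<in> {0..1} \<rightarrow> cball \<xi>c r" by simp
    show "?\<gamma> 1 = ?\<gamma> 0" by (simp add: circle_param_def)
  qed
  have svd: "smooth_svd 1 (\<lambda>t. A (?\<gamma> t)) U s V" using assms(8) by (simp add: joint_mvd_def)
  then have unitary: "unitary_matrix (U t)" "unitary_matrix (V t)" if "t \<in> {0..1}" for t
    using that by (auto simp: smooth_svd_def)
  have contU: "continuous_on {0..1} U"
    using svd unfolding smooth_svd_def Ck_on_1 by (blast intro: continuous_on_vector_derivative)
  obtain c where c: "\<And>t. t \<in> {0..1} \<Longrightarrow> det (U t) * det (V t) = c"
    using joint_mvd_det_product_constant[OF assms(8)] by blast
  \<comment> \<open>On the circle, \<open>det A\<close> is a nonnegative multiple of a constant times a square. The square root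
    of that multiple is absorbed into the square, so that the result is a square times a constant.\<close>
  have factor: "det (A (?\<gamma> t)) = cnj c * (sqrt (cmod (det (A (?\<gamma> t)))) * det (U t))\<^sup>2"
    if t: "t \<in> {0..1}" for t
  proof -
    define \<rho> where "\<rho> = (\<Prod>j\<in>UNIV. s t $ j)"
    have "det (A (?\<gamma> t)) = det (U t) * of_real \<rho> * cnj (det (V t))"
      using svd t unfolding smooth_svd_def \<rho>_def
      by (simp add: det_mul det_diag_matrix det_ctranspose)
    moreover have "\<rho> \<ge> 0"
      using svd t unfolding smooth_svd_def \<rho>_def by (simp add: prod_nonneg)
    ultimately have "cmod (det (A (?\<gamma> t))) = \<rho>" and detA: "det (A (?\<gamma> t)) = det (U t) * of_real \<rho> * cnj (det (V t))"
      using cmod_det_unitary[OF unitary(1)[OF t]] cmod_det_unitary[OF unitary(2)[OF t]]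
      by (simp_all add: norm_mult)
    moreover have "det (U t) * cnj (det (U t)) = 1"
      using cmod_det_unitary[OF unitary(1)[OF t]] by (simp flip: complex_norm_square)
    moreover have "cnj c * (det (U t))\<^sup>2 = (det (U t) * cnj (det (U t))) * (det (U t) * cnj (det (V t)))"
      unfolding c[OF t, symmetric] by (simp add: power2_eq_square ac_simps)
    ultimately show ?thesis
      using \<open>\<rho> \<ge> 0\<close> by (simp add: power_mult_distrib flip: of_real_power)
  qed
  have contA\<gamma>: "continuous_on {0..1} (\<lambda>t. A (?\<gamma> t))"
    using continuous_on_compose2[OF contA \<gamma>(1)] \<gamma>(2) by blast
  have cont_root: "continuous_on {0..1}
      (\<lambda>t. complex_of_real (sqrt (cmod (det (A (?\<gamma> t))))) * det (U t))"
    by (intro continuous_intros cont_det[OF contA\<gamma>] cont_det[OF contU])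
  \<comment> \<open>Here invertibility on the whole disc is used, not just on the circle.\<close>
  have "complex_of_real (sqrt (cmod (det (A (?\<gamma> 1))))) * det (U 1)
      = complex_of_real (sqrt (cmod (det (A (?\<gamma> 0))))) * det (U 0)"
    by (rule square_factor_of_nonvanishing_returns[OF cont_det[OF contA] nz \<gamma> cont_root factor])
  then have "det (U 1) = det (U 0)"
    using nz[OF funcset_mem[OF \<gamma>(2)], of 0] \<gamma>(3) by simp
  moreover have "det (U 1) = - det (U 0)"
  proof -
    obtain n where "pi = (\<Sum>j\<in>UNIV. \<beta> j) + of_int n * (2 * pi)"
      using assms(10) unfolding rcong_altdef by blast
    then have "(\<Sum>j\<in>UNIV. \<beta> j) = pi + 2 * pi * of_int (- n)" by (simp add: algebra_simps)
    then have "cis (\<Sum>j\<in>UNIV. \<beta> j) = cis pi * cis (2 * pi * of_int (- n))"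
      by (simp only: cis_mult)
    then have "cis (\<Sum>j\<in>UNIV. \<beta> j) = - 1"
      using cis_multiple_2pi[of "of_int (- n)"] by simp
    moreover have "cnj (det (U 0)) * det (U 1) = cis (\<Sum>j\<in>UNIV. \<beta> j)"
    proof -
      have "cnj (det (U 0)) * det (U 1) = det (ctranspose (U 0) ** U 1)"
        by (simp add: det_mul det_ctranspose)
      also have "\<dots> = det (diag_matrix (\<lambda>j. cis (\<beta> j)))"
        using assms(9) by (simp add: accrued_phases_def)
      finally show ?thesis by (simp add: det_diag_matrix prod_cis)
    qed
    moreover have "det (U 0) * cnj (det (U 0)) = 1"
      using cmod_det_unitary[OF unitary(1)[of 0]] by (simp flip: complex_norm_square)
    then have "det (U 1) = det (U 0) * (cnj (det (U 0)) * det (U 1))"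
      by (simp flip: mult.assoc)
    ultimately show ?thesis by simp
  qed
  moreover have "det (U 0) \<noteq> 0" using cmod_det_unitary[OF unitary(1)[of 0]] by auto
  ultimately show False by simp
qed

end
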